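(* Let $T$ be a Fréchet space, $B$ a Banach space, $V\subset T$ and $O_B\subset B$ open sets, and let $A:V\times O_B\to B$ be a $C^1_F$-map. Assume that for a nonempty closed set $M\subset B$ with $M\subset O_B$ we have $A(V\times M)\subset M$, and that $A$ is a uniform contraction in the sense that there exists $k\in[0,1)$ so that $$|A(t,x)-A(t,y)|\le k|x-y|\quad\text{for all } t\in V,\ x\in O_B,\ y\in O_B.$$ Then the map $g:V\to B$ given by $g(t)=A(t,g(t))\in M$ is $C^1_F$-smooth.
   Context: For topological vector spaces $V,W$, $L_c(V,W)$ denotes the vector space of continuous linear maps $V\to W$; the topology $\beta$ on $L_c(V,W)$ is that of uniform convergence on bounded sets (basic neighbourhoods of $0$: $\{A\in L_c(V,W): AB\subset N\}$ with $B\subset V$ bounded and $N$ a neighbourhood of $0$ in $W$). A continuous map $f:V\supset U\to W$, $U$ open, is $C^1_F$-smooth (a $C^1_F$-map) if all directional derivatives $Df(u)v=\lim_{0\ne t\to0}\frac1t(f(u+tv)-f(u))$, $u\in U$, $v\in V$, exist, each $Df(u):V\to W$ is linear and continuous, and $U\ni u\mapsto Df(u)\in L_c(V,W)$ is continuous with respect to $\beta$. Products carry the product topology. *)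

theory Defs
  imports "HOL-Analysis.Analysis"
begin

section \<open>Topological vector spaces and Frechet spaces\<close>

text \<open>Separatedness is not part of the class; it is added as the sort \<^class>\<open>t2_space\<close>
  where uniqueness of limits is needed. The class does not extend
  \<^class>\<open>topological_ab_group_add\<close>, because the arity of products in
  \<^class>\<open>topological_monoid_add\<close> is already fixed to normed factors and products of topological
  vector spaces could then not be an instance. Continuity of negation follows from that of the
  scalar multiplication.\<close>

class topological_real_vector = real_vector + topological_space +
  assumes tendsto_plus_Pair:
    "LIM x (nhds a \<times>\<^sub>F nhds b). fst x + snd x :> nhds (a + b)"
  assumes tendsto_scaleR_Pair:
    "LIM x (nhds c \<times>\<^sub>F nhds a). fst x *\<^sub>R snd x :> nhds (c *\<^sub>R a)"

lemma tendsto_plus_tvs: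
  fixes f g :: "'b \<Rightarrow> 'a::topological_real_vector"
  assumes "(f \<longlongrightarrow> a) F" "(g \<longlongrightarrow> b) F"
  shows "((\<lambda>x. f x + g x) \<longlongrightarrow> a + b) F"
  using filterlim_compose[OF tendsto_plus_Pair, of "\<lambda>x. (f x, g x)" a b F]
  by (simp add: assms filterlim_Pair)

lemma tendsto_scaleR_tvs:
  fixes g :: "'b \<Rightarrow> 'a::topological_real_vector"
  assumes "(f \<longlongrightarrow> c) F" "(g \<longlongrightarrow> a) F"
  shows "((\<lambda>x. f x *\<^sub>R g x) \<longlongrightarrow> c *\<^sub>R a) F"
  using filterlim_compose[OF tendsto_scaleR_Pair, of "\<lambda>x. (f x, g x)" c a F]
  by (simp add: assms filterlim_Pair)

lemma tendsto_fst_snd_nhds_prod: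
  "((\<lambda>x. fst x) \<longlongrightarrow> a) (nhds a \<times>\<^sub>F nhds b)" "((\<lambda>x. snd x) \<longlongrightarrow> b) (nhds a \<times>\<^sub>F nhds b)"
  by (simp_all add: filterlim_fst filterlim_snd)

instance real_normed_vector \<subseteq> topological_real_vector
  by standard (intro tendsto_add tendsto_scaleR tendsto_fst_snd_nhds_prod)+

instance prod :: (topological_real_vector, topological_real_vector) topological_real_vector
proof
  fix a b :: "'a \<times> 'b"
  note lim = tendsto_fst_snd_nhds_prod[where a = a and b = b]
  have "((\<lambda>x. (fst (fst x) + fst (snd x), snd (fst x) + snd (snd x)))
      \<longlongrightarrow> (fst a + fst b, snd a + snd b)) (nhds a \<times>\<^sub>F nhds b)"
    by (intro tendsto_Pair tendsto_plus_tvs lim[THEN tendsto_fst] lim[THEN tendsto_snd])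
  then show "LIM x (nhds a \<times>\<^sub>F nhds b). fst x + snd x :> nhds (a + b)"
    by (simp add: plus_prod_def)
next
  fix c :: real and a :: "'a \<times> 'b"
  note lim = tendsto_fst_snd_nhds_prod[where a = c and b = a]
  have "((\<lambda>x. (fst x *\<^sub>R fst (snd x), fst x *\<^sub>R snd (snd x)))
      \<longlongrightarrow> (c *\<^sub>R fst a, c *\<^sub>R snd a)) (nhds c \<times>\<^sub>F nhds a)"
    by (intro tendsto_Pair tendsto_scaleR_tvs lim(1) lim(2)[THEN tendsto_fst]
        lim(2)[THEN tendsto_snd])
  then show "LIM x (nhds c \<times>\<^sub>F nhds a). fst x *\<^sub>R snd x :> nhds (c *\<^sub>R a)"
    by (simp add: scaleR_prod_def)
qed

text \<open>A Frechet space is a locally convex topological vector space whose topology is induced by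
  some complete translation-invariant metric; no particular metric is part of the structure.
  The constants \<^const>\<open>convex\<close> and \<^const>\<open>euclidean\<close> are not local to a class and cannot occur
  in a class specification, so they are unfolded here and recovered below.\<close>

class frechet_space = topological_real_vector +
  assumes locally_convex_unfolded:
    "open N \<Longrightarrow> 0 \<in> N \<Longrightarrow> \<exists>C. open C \<and>
       (\<forall>x\<in>C. \<forall>y\<in>C. \<forall>u\<ge>0. \<forall>v\<ge>0. u + v = 1 \<longrightarrow> u *\<^sub>R x + v *\<^sub>R y \<in> C) \<and>
       0 \<in> C \<and> C \<subseteq> N"
  assumes complete_invariant_metric_unfolded:
    "\<exists>d. Metric_space UNIV d \<and> Metric_space.mtopology UNIV d = topology open \<and>
         Metric_space.mcomplete UNIV d \<and> (\<forall>x y z. d (x + z) (y + z) = d x y)"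

lemma locally_convex:
  fixes N :: "'a::frechet_space set"
  assumes "open N" "0 \<in> N"
  shows "\<exists>C. open C \<and> convex C \<and> 0 \<in> C \<and> C \<subseteq> N"
  using locally_convex_unfolded[OF assms] unfolding convex_def .

lemma complete_invariant_metric:
  "\<exists>d. Metric_space (UNIV :: 'a::frechet_space set) d \<and>
       Metric_space.mtopology UNIV d = euclidean \<and>
       Metric_space.mcomplete UNIV d \<and> (\<forall>x y z. d (x + z) (y + z) = d x y)"
  by (rule complete_invariant_metric_unfolded)

instance banach \<subseteq> frechet_space
proof
  fix N :: "'a set"
  assume "open N" "0 \<in> N"
  then obtain e where "e > 0" "ball 0 e \<subseteq> N"
    using open_contains_ball by blast
  then have "open (ball (0 :: 'a) e) \<and> convex (ball (0 :: 'a) e) \<and> 0 \<in> ball (0 :: 'a) e \<and> ball 0 e \<subseteq> N"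
    by simp
  then show "\<exists>C. open C \<and>
       (\<forall>x\<in>C. \<forall>y\<in>C. \<forall>u\<ge>0. \<forall>v\<ge>0. u + v = 1 \<longrightarrow> u *\<^sub>R x + v *\<^sub>R y \<in> C) \<and> 0 \<in> C \<and> C \<subseteq> N"
    unfolding convex_def by blast
next
  have "Met_TC.mcomplete (TYPE('a))"
    by (simp add: mcomplete_iff_complete complete_UNIV)
  then show "\<exists>d. Metric_space (UNIV :: 'a set) d \<and> Metric_space.mtopology UNIV d = euclidean \<and>
         Metric_space.mcomplete UNIV d \<and> (\<forall>x y z. d (x + z) (y + z) = d x y)"
    by (intro exI[of _ dist]) (auto simp: Met_TC.Metric_space_axioms)
qed


section \<open>The topology of uniform convergence on bounded sets\<close>

text \<open>Boundedness in the sense of topological vector spaces, not \<^const>\<open>bounded\<close> with respect to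
  some metric: a bounded set is absorbed by all sufficiently large multiples of every
  neighbourhood of zero.\<close>

definition tvs_bounded :: "'a::topological_real_vector set \<Rightarrow> bool" where
  "tvs_bounded B \<longleftrightarrow>
     (\<forall>N. open N \<and> 0 \<in> N \<longrightarrow> (\<exists>r>0. \<forall>s\<ge>r. B \<subseteq> (\<lambda>x. s *\<^sub>R x) ` N))"

lemma tvs_bounded_empty: "tvs_bounded {}"
  by (auto simp: tvs_bounded_def intro: exI[of _ 1])

lemma tvs_bounded_Un:
  assumes "tvs_bounded A" "tvs_bounded B"
  shows "tvs_bounded (A \<union> B)"
  unfolding tvs_bounded_def
proof (intro allI impI)
  fix N :: "'a set"
  assume N: "open N \<and> 0 \<in> N"
  obtain r where r: "r > 0" "\<And>s. s \<ge> r \<Longrightarrow> A \<subseteq> (\<lambda>x. s *\<^sub>R x) ` N"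
    using assms(1) N unfolding tvs_bounded_def by meson
  obtain r' where r': "r' > 0" "\<And>s. s \<ge> r' \<Longrightarrow> B \<subseteq> (\<lambda>x. s *\<^sub>R x) ` N"
    using assms(2) N unfolding tvs_bounded_def by meson
  show "\<exists>r>0. \<forall>s\<ge>r. A \<union> B \<subseteq> (\<lambda>x. s *\<^sub>R x) ` N"
    using r r' by (intro exI[of _ "max r r'"]) auto
qed

definition cont_linear_maps ::
    "('a::topological_real_vector \<Rightarrow> 'b::topological_real_vector) set" where
  "cont_linear_maps = {L. linear L \<and> continuous_on UNIV L}"

text \<open>The carrier is \<^const>\<open>cont_linear_maps\<close>; the sets \<open>{L'. (L' - L) B \<subseteq> N}\<close>, with \<open>B\<close> bounded
  and \<open>N\<close> a neighbourhood of zero, form a base of neighbourhoods of \<open>L\<close>.\<close>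

definition beta_topology ::
    "('a::topological_real_vector \<Rightarrow> 'b::topological_real_vector) topology" where
  "beta_topology = topology (\<lambda>S. S \<subseteq> cont_linear_maps \<and>
     (\<forall>L\<in>S. \<exists>B N. tvs_bounded B \<and> open N \<and> 0 \<in> N \<and>
        {L' \<in> cont_linear_maps. (\<lambda>v. L' v - L v) ` B \<subseteq> N} \<subseteq> S))"

lemma openin_beta_topology:
  "openin beta_topology S \<longleftrightarrow> S \<subseteq> cont_linear_maps \<and>
     (\<forall>L\<in>S. \<exists>B N. tvs_bounded B \<and> open N \<and> 0 \<in> N \<and>
        {L' \<in> cont_linear_maps. (\<lambda>v. L' v - L v) ` B \<subseteq> N} \<subseteq> S)"
proof -
  let ?P = "\<lambda>L B N (S :: ('a \<Rightarrow> 'b) set). tvs_bounded B \<and> open N \<and> 0 \<in> N \<and>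
        {L' \<in> cont_linear_maps. (\<lambda>v. L' v - L v) ` B \<subseteq> N} \<subseteq> S"
  have "istopology (\<lambda>S. S \<subseteq> cont_linear_maps \<and> (\<forall>L\<in>S. \<exists>B N. ?P L B N S))"
    unfolding istopology_def
  proof (intro conjI allI impI ballI)
    fix S T L
    assume S: "S \<subseteq> cont_linear_maps \<and> (\<forall>L\<in>S. \<exists>B N. ?P L B N S)"
      and T: "T \<subseteq> cont_linear_maps \<and> (\<forall>L\<in>T. \<exists>B N. ?P L B N T)"
      and L: "L \<in> S \<inter> T"
    obtain B N where 1: "?P L B N S" using S L by (meson IntD1)
    obtain B' N' where 2: "?P L B' N' T" using T L by (meson IntD2)
    have "{L' \<in> cont_linear_maps. (\<lambda>v. L' v - L v) ` (B \<union> B') \<subseteq> N \<inter> N'} \<subseteq> S \<inter> T"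
      (is "?X \<subseteq> _")
    proof (rule Int_greatest)
      have "?X \<subseteq> {L' \<in> cont_linear_maps. (\<lambda>v. L' v - L v) ` B \<subseteq> N}" by auto
      then show "?X \<subseteq> S" using 1 by (meson order_trans)
      have "?X \<subseteq> {L' \<in> cont_linear_maps. (\<lambda>v. L' v - L v) ` B' \<subseteq> N'}" by auto
      then show "?X \<subseteq> T" using 2 by (meson order_trans)
    qed
    then have "?P L (B \<union> B') (N \<inter> N') (S \<inter> T)"
      using 1 2 by (simp add: tvs_bounded_Un open_Int)
    then show "\<exists>B N. ?P L B N (S \<inter> T)" by blast
  next
    fix K L
    assume K: "\<forall>S\<in>K. S \<subseteq> cont_linear_maps \<and> (\<forall>L\<in>S. \<exists>B N. ?P L B N S)" and "L \<in> \<Union>K"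
    then obtain S where "S \<in> K" "L \<in> S" by blast
    with K obtain B N where 1: "?P L B N S" by meson
    moreover have "S \<subseteq> \<Union>K" using \<open>S \<in> K\<close> by (rule Union_upper)
    ultimately have "?P L B N (\<Union>K)" by (meson order_trans)
    then show "\<exists>B N. ?P L B N (\<Union>K)" by blast
  qed auto
  then show ?thesis
    by (simp add: beta_topology_def)
qed

lemma topspace_beta_topology: "topspace beta_topology = cont_linear_maps"
proof -
  have "openin beta_topology cont_linear_maps"
    unfolding openin_beta_topology using tvs_bounded_empty open_UNIV by blast
  then show ?thesis
    by (metis openin_beta_topology openin_subset openin_topspace subset_antisym)
qed


section \<open>Maps of class \<open>C\<^sup>1\<^sub>F\<close>\<close>

definition dir_quotient ::
    "('a::topological_real_vector \<Rightarrow> 'b::topological_real_vector) \<Rightarrow> 'a \<Rightarrow> 'a \<Rightarrow> real \<Rightarrow> 'b" where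
  "dir_quotient f u v t = (1 / t) *\<^sub>R (f (u + t *\<^sub>R v) - f u)"

definition dir_deriv ::
    "('a::topological_real_vector \<Rightarrow> 'b::{topological_real_vector, t2_space}) \<Rightarrow> 'a \<Rightarrow> 'a \<Rightarrow> 'b" where
  "dir_deriv f u v = Lim (at 0) (dir_quotient f u v)"

text \<open>Functions are total, but only the values of \<open>f\<close> on the open set \<open>U\<close> matter, since
  \<open>u + t v \<in> U\<close> for all \<open>t\<close> close to zero.\<close>

definition C1F_on ::
    "'a::topological_real_vector set \<Rightarrow> ('a \<Rightarrow> 'b::{topological_real_vector, t2_space}) \<Rightarrow> bool" where
  "C1F_on U f \<longleftrightarrow> open U \<and> continuous_on U f \<and>
     (\<forall>u\<in>U. \<forall>v. \<exists>w. (dir_quotient f u v \<longlongrightarrow> w) (at 0)) \<and>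
     (\<forall>u\<in>U. linear (dir_deriv f u) \<and> continuous_on UNIV (dir_deriv f u)) \<and>
     continuous_map (top_of_set U) beta_topology (dir_deriv f)"

end

theory Submission
  imports Defs
begin

text \<open>Everything rests on perturbing the argument of a contraction \<open>C\<close> with constant \<open>k\<close>: if \<open>x = C x\<close>
  then \<open>|x - y| \<le> |C y - y| / (1 - k)\<close>. Writing \<open>D\<close> for the derivative of \<open>A\<close> at \<open>(t, g t)\<close>, the derivative
  \<open>w\<close> of \<open>g\<close> at \<open>t\<close> in direction \<open>v\<close> is the fixed point of the contraction \<open>y \<mapsto> D (v, y)\<close>. The estimate
  with \<open>x = g (t + h v)\<close>, \<open>y = g t + h w\<close> reduces the differentiability of \<open>g\<close> to the directional
  differentiability of \<open>A\<close> at \<open>(t, g t)\<close> in the single direction \<open>(v, w)\<close>, and no mean value theorem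
  is needed. Applied to the linearised equation, the estimate bounds \<open>Dg(s) - Dg(t)\<close> on a bounded set
  \<open>B\<close> by \<open>DA(s, g s) - DA(t, g t)\<close> on the bounded set of the pairs \<open>(v, Dg(t) v)\<close> with \<open>v \<in> B\<close>.\<close>

section \<open>Perturbation of fixed points of contractions\<close>

text \<open>Here \<open>x\<close> is the fixed point and \<open>z\<close> stands for
  \<open>C y\<close>. The contraction enters only through the one inequality, so the same estimate
  serves for values, difference quotients and derivatives.\<close>

lemma contraction_perturbation:
  fixes x y z :: "'b::real_normed_vector"
  assumes "norm (x - z) \<le> k * norm (x - y)" "k < 1"
  shows "norm (x - y) \<le> norm (z - y) / (1 - k)"
proof -
  have "norm (x - y) \<le> norm (x - z) + norm (z - y)"
    by (rule norm_diff_triangle_ineq[of x z z y, simplified])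
  with assms show ?thesis
    by (simp add: field_simps)
qed

lemma tendsto_contraction_perturbation:
  fixes x y z :: "'a \<Rightarrow> 'b::real_normed_vector"
  assumes "\<forall>\<^sub>F s in F. norm (x s - z s) \<le> k * norm (x s - y s)" "k < 1"
    and "((\<lambda>s. z s - y s) \<longlongrightarrow> 0) F"
  shows "((\<lambda>s. x s - y s) \<longlongrightarrow> 0) F"
proof (rule Lim_null_comparison)
  show "\<forall>\<^sub>F s in F. norm (x s - y s) \<le> norm (z s - y s) / (1 - k)"
    using assms(1) by eventually_elim (rule contraction_perturbation[OF _ \<open>k < 1\<close>])
  show "((\<lambda>s. norm (z s - y s) / (1 - k)) \<longlongrightarrow> 0) F"
    using tendsto_divide[OF tendsto_norm_zero[OF assms(3)] tendsto_const, of "1 - k"] \<open>k < 1\<close>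
    by simp
qed

section \<open>Bounded sets and continuity into \<open>beta_topology\<close>\<close>

lemma eventually_direction_in_open:
  fixes u v :: "'a::topological_real_vector"
  assumes "open U" "u \<in> U"
  shows "\<forall>\<^sub>F h in at 0. u + h *\<^sub>R v \<in> U"
proof -
  have "((\<lambda>h::real. u + h *\<^sub>R v) \<longlongrightarrow> u + 0 *\<^sub>R v) (at 0)"
    by (intro tendsto_plus_tvs tendsto_scaleR_tvs tendsto_const tendsto_ident_at)
  with assms show ?thesis
    by (simp add: topological_tendstoD)
qed

lemma tvs_bounded_linear_image:
  fixes L :: "'a::topological_real_vector \<Rightarrow> 'b::topological_real_vector"
  assumes "L \<in> cont_linear_maps" "tvs_bounded B"
  shows "tvs_bounded (L ` B)"
  unfolding tvs_bounded_def
proof (intro allI impI)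
  have L: "linear L" "continuous_on UNIV L"
    using assms(1) by (auto simp: cont_linear_maps_def)
  fix N :: "'b set" assume N: "open N \<and> 0 \<in> N"
  have "open (L -` N)" "0 \<in> L -` N"
    using L N by (auto simp: linear_0 intro: open_vimage)
  then obtain r where r: "r > 0" "\<And>s. s \<ge> r \<Longrightarrow> B \<subseteq> (\<lambda>x. s *\<^sub>R x) ` (L -` N)"
    using assms(2) unfolding tvs_bounded_def by meson
  have "L ` B \<subseteq> (\<lambda>x. s *\<^sub>R x) ` N" if s: "s \<ge> r" for s
  proof
    fix y assume "y \<in> L ` B"
    then obtain x where "x \<in> L -` N" "y = L (s *\<^sub>R x)"
      using r(2)[OF s] by blast
    then show "y \<in> (\<lambda>x. s *\<^sub>R x) ` N"
      by (auto simp: linear_scale[OF L(1)])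
  qed
  with r(1) show "\<exists>r>0. \<forall>s\<ge>r. L ` B \<subseteq> (\<lambda>x. s *\<^sub>R x) ` N" by blast
qed

text \<open>A basic neighbourhood of \<open>L\<close> need not itself be open. In the forward direction its role is taken by
  the set of those \<open>L'\<close> for which the supremum of \<open>|L' - L|\<close> over the bounded set is strictly below
  \<open>e\<close>.\<close>

lemma continuous_map_beta_topology_iff:
  fixes F :: "'c::topological_space \<Rightarrow> 'a::topological_real_vector \<Rightarrow> 'b::real_normed_vector"
  shows "continuous_map (top_of_set U) beta_topology F \<longleftrightarrow>
    F ` U \<subseteq> cont_linear_maps \<and>
    (\<forall>u\<in>U. \<forall>B e. tvs_bounded B \<longrightarrow> 0 < e \<longrightarrow>
       (\<forall>\<^sub>F s in at u within U. \<forall>v\<in>B. norm (F s v - F u v) < e))"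
    (is "?L \<longleftrightarrow> ?R")
proof
  assume cont: ?L
  have "\<forall>\<^sub>F s in at u within U. \<forall>v\<in>B. norm (F s v - F u v) < e"
    if u: "u \<in> U" and B: "tvs_bounded B" and e: "0 < e" for u B and e :: real
  proof -
    define S where "S = {L \<in> cont_linear_maps. \<exists>d<e. \<forall>v\<in>B. norm (L v - F u v) \<le> d}"
    have "openin beta_topology S"
      unfolding openin_beta_topology
    proof (intro conjI ballI)
      fix L assume "L \<in> S"
      then obtain d where d: "d < e" "\<And>v. v \<in> B \<Longrightarrow> norm (L v - F u v) \<le> d"
        unfolding S_def by blast
      \<comment> \<open>Only half of the gap between \<open>d\<close> and \<open>e\<close> is spent,
        so the new bound \<open>(e + d) / 2\<close> stays strictly below \<open>e\<close>.\<close>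
      have "L' \<in> S" if L': "L' \<in> cont_linear_maps"
        and near: "(\<lambda>v. L' v - L v) ` B \<subseteq> ball 0 ((e - d) / 2)" for L'
      proof -
        have "norm (L' v - F u v) \<le> (e + d) / 2" if "v \<in> B" for v
        proof -
          have "norm (L' v - L v) < (e - d) / 2" using near that by auto
          moreover have "norm (L' v - F u v) \<le> norm (L' v - L v) + norm (L v - F u v)"
            by (rule norm_diff_triangle_ineq[of "L' v" "L v" "L v" "F u v", simplified])
          ultimately show ?thesis using d(2)[OF that] by (simp add: field_simps)
        qed
        moreover have "(e + d) / 2 < e" using d(1) by simp
        ultimately show ?thesis using L' unfolding S_def by blast
      qed
      then have "{L' \<in> cont_linear_maps. (\<lambda>v. L' v - L v) ` B \<subseteq> ball 0 ((e - d) / 2)} \<subseteq> S"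
        by blast
      moreover have "0 \<in> ball (0::'b) ((e - d) / 2)" using d(1) by simp
      ultimately show "\<exists>B N. tvs_bounded B \<and> open N \<and> 0 \<in> N \<and>
          {L' \<in> cont_linear_maps. (\<lambda>v. L' v - L v) ` B \<subseteq> N} \<subseteq> S"
        using B open_ball by blast
    qed (auto simp: S_def)
    then have "openin (top_of_set U) {s \<in> U. F s \<in> S}"
      using openin_continuous_map_preimage[OF cont] by simp
    then obtain W where W: "open W" "{s \<in> U. F s \<in> S} = U \<inter> W"
      by (auto simp: openin_open)
    have "F u \<in> cont_linear_maps"
      using continuous_map_image_subset_topspace[OF cont] u by (auto simp: topspace_beta_topology)
    then have "F u \<in> S"
      using e by (auto simp: S_def intro: exI[of _ 0])
    then have "u \<in> W" using W(2) u by blast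
    then have "\<forall>\<^sub>F s in at u within U. s \<in> U \<inter> W"
      using W(1) unfolding eventually_at_topological by blast
    then show ?thesis
    proof eventually_elim
      case (elim s)
      then have "F s \<in> S" using W(2) by blast
      then obtain d where "d < e" "\<forall>v\<in>B. norm (F s v - F u v) \<le> d"
        unfolding S_def by blast
      then show ?case by (meson le_less_trans)
    qed
  qed
  then show ?R
    using continuous_map_image_subset_topspace[OF cont] by (auto simp: topspace_beta_topology)
next
  assume R: ?R
  show ?L
    unfolding continuous_map_def
  proof (intro conjI allI impI)
    show "F \<in> topspace (top_of_set U) \<rightarrow> topspace beta_topology"
      using R by (auto simp: topspace_beta_topology)
    fix S :: "('a \<Rightarrow> 'b) set" assume S: "openin beta_topology S"
    have "\<exists>T. openin (top_of_set U) T \<and> u \<in> T \<and> T \<subseteq> {s \<in> U. F s \<in> S}"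
      if u: "u \<in> U" "F u \<in> S" for u
    proof -
      obtain B N where BN: "tvs_bounded B" "open N" "0 \<in> N"
        "{L' \<in> cont_linear_maps. (\<lambda>v. L' v - F u v) ` B \<subseteq> N} \<subseteq> S"
        using S u(2) unfolding openin_beta_topology by meson
      obtain e where e: "e > 0" "ball 0 e \<subseteq> N"
        using BN(2,3) open_contains_ball by blast
      have "\<forall>\<^sub>F s in at u within U. \<forall>v\<in>B. norm (F s v - F u v) < e"
        using R u(1) BN(1) e(1) by blast
      then obtain W where W: "open W" "u \<in> W"
        "\<And>s v. s \<in> W \<Longrightarrow> s \<noteq> u \<Longrightarrow> s \<in> U \<Longrightarrow> v \<in> B \<Longrightarrow> norm (F s v - F u v) < e"
        unfolding eventually_at_topological by blast
      have "F s \<in> S" if "s \<in> U \<inter> W" for s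
      \<comment> \<open>The filter \<open>at u within U\<close> says nothing about \<open>u\<close>
        itself, where membership in \<open>S\<close> is an assumption.\<close>
      proof (cases "s = u")
        case False
        have "(\<lambda>v. F s v - F u v) ` B \<subseteq> ball 0 e"
          using W(3) False that by auto
        moreover have "F s \<in> cont_linear_maps" using R that by blast
        ultimately show ?thesis using BN(4) e(2) by blast
      qed (use u in simp)
      with W(1,2) u(1) show ?thesis
        by (intro exI[of _ "U \<inter> W"]) (auto simp: openin_open_Int)
    qed
    then have "openin (top_of_set U) {s \<in> U. F s \<in> S}"
      by (subst openin_subopen) blast
    then show "openin (top_of_set U) {x \<in> topspace (top_of_set U). F x \<in> S}"
      by simp
  qed
qed

section \<open>Working with the directional derivative\<close>

lemma C1F_on_tendsto_dir_deriv:
  assumes "C1F_on U f" "u \<in> U"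
  shows "(dir_quotient f u v \<longlongrightarrow> dir_deriv f u v) (at 0)"
proof -
  obtain w where w: "(dir_quotient f u v \<longlongrightarrow> w) (at 0)"
    using assms unfolding C1F_on_def by blast
  then have "dir_deriv f u v = w"
    unfolding dir_deriv_def by (intro tendsto_Lim) simp_all
  with w show ?thesis by simp
qed

lemma C1F_on_dir_deriv_cont_linear:
  assumes "C1F_on U f" "u \<in> U"
  shows "dir_deriv f u \<in> cont_linear_maps"
  using assms by (simp add: C1F_on_def cont_linear_maps_def)

text \<open>A candidate \<open>D\<close> can be verified in place of \<open>dir_deriv\<close>:
  uniqueness of limits makes the two agree on \<open>U\<close>, and the topology is traded for
  uniform estimates on bounded sets.\<close>

lemma C1F_onI:
  fixes f :: "'a::topological_real_vector \<Rightarrow> 'b::real_normed_vector"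
  assumes "open U" "continuous_on U f"
    and lin: "\<And>u. u \<in> U \<Longrightarrow> D u \<in> cont_linear_maps"
    and lim: "\<And>u v. u \<in> U \<Longrightarrow> (dir_quotient f u v \<longlongrightarrow> D u v) (at 0)"
    and cont: "\<And>u B e. \<lbrakk>u \<in> U; tvs_bounded B; 0 < e\<rbrakk> \<Longrightarrow>
      \<forall>\<^sub>F s in at u within U. \<forall>v\<in>B. norm (D s v - D u v) < e"
  shows "C1F_on U f"
proof -
  have D: "dir_deriv f u = D u" if "u \<in> U" for u
    unfolding dir_deriv_def by (rule ext, rule tendsto_Lim) (auto intro: lim that)
  have "continuous_map (top_of_set U) beta_topology D"
    unfolding continuous_map_beta_topology_iff using lin cont by auto
  then have "continuous_map (top_of_set U) beta_topology (dir_deriv f)"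
    by (rule continuous_map_eq) (simp add: D)
  with assms(1,2) lim lin show ?thesis
    unfolding C1F_on_def by (auto simp: D cont_linear_maps_def)
qed

section \<open>The linearised fixed-point equation\<close>

text \<open>The direction \<open>(0, y)\<close> leaves \<open>t\<close> fixed, so for small
  \<open>h\<close> the Lipschitz condition bounds each difference quotient, and the bound survives
  the limit.\<close>

lemma norm_dir_deriv_le_lipschitz:
  fixes A :: "'t::topological_real_vector \<times> 'b::real_normed_vector \<Rightarrow> 'b"
  assumes A: "C1F_on (V \<times> O\<^sub>B) A" and "open O\<^sub>B" "t \<in> V" "x \<in> O\<^sub>B"
    and lip: "\<And>t x y. t \<in> V \<Longrightarrow> x \<in> O\<^sub>B \<Longrightarrow> y \<in> O\<^sub>B \<Longrightarrow>
           norm (A (t, x) - A (t, y)) \<le> k * norm (x - y)"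
  shows "norm (dir_deriv A (t, x) (0, y)) \<le> k * norm y"
proof (rule tendsto_upperbound)
  show "((\<lambda>h. norm (dir_quotient A (t, x) (0, y) h)) \<longlongrightarrow> norm (dir_deriv A (t, x) (0, y))) (at 0)"
    using assms by (intro tendsto_norm C1F_on_tendsto_dir_deriv[OF A]) auto
  have "\<forall>\<^sub>F h in at 0. x + h *\<^sub>R y \<in> O\<^sub>B"
    using assms by (intro eventually_direction_in_open)
  with eventually_neq_at_within[of 0]
  show "\<forall>\<^sub>F h in at 0. norm (dir_quotient A (t, x) (0, y) h) \<le> k * norm y"
  proof eventually_elim
    case (elim h)
    then show ?case
      using lip[of t "x + h *\<^sub>R y" x] assms(3,4)
      by (simp add: dir_quotient_def divide_simps mult_ac)
  qed
qed simp

text \<open>By linearity of \<open>D\<close>, each map \<open>y \<mapsto> D (v, y)\<close> is a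
  contraction. Uniqueness of its fixed point makes \<open>W\<close> linear, because sums and
  multiples of solutions solve the equation again. With \<open>D\<close> the derivative of
  \<open>A\<close>, this \<open>W\<close> is the derivative given by implicit
  differentiation.\<close>

lemma linear_fixed_point:
  fixes D :: "'t::topological_real_vector \<times> 'b::banach \<Rightarrow> 'b"
  assumes D: "D \<in> cont_linear_maps" and "0 \<le> k" "k < 1"
    and le: "\<And>y. norm (D (0, y)) \<le> k * norm y"
  obtains W where "W \<in> cont_linear_maps" "\<And>v. W v = D (v, W v)"
proof -
  have lin: "linear D" and cont: "continuous_on UNIV D"
    using D by (auto simp: cont_linear_maps_def)
  have contr: "norm (D (v, x) - D (v, y)) \<le> k * norm (x - y)" for v x y
    using le[of "x - y"] linear_diff[OF lin, of "(v, x)" "(v, y)"] by simp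
  have ex1: "\<exists>!w. D (v, w) = w" for v
    using Banach_fix[of UNIV k "\<lambda>y. D (v, y)"] contr assms(2,3)
    by (auto simp: complete_UNIV dist_norm)
  define W where "W v = (THE w. D (v, w) = w)" for v
  have W: "D (v, W v) = W v" for v
    unfolding W_def by (rule theI'[OF ex1])
  have W_eqI: "W v = w" if "D (v, w) = w" for v w
    using ex1[of v] W[of v] that by blast
  have linW: "linear W"
  proof (rule linearI)
    show "W (u + v) = W u + W v" for u v
      using linear_add[OF lin, of "(u, W u)" "(v, W v)"] W by (intro W_eqI) simp
    show "W (c *\<^sub>R v) = c *\<^sub>R W v" for c v
      using linear_scale[OF lin, of c "(v, W v)"] W by (intro W_eqI) simp
  qed
  \<comment> \<open>For the contraction belonging to \<open>v\<close>, the fixed point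
    \<open>W v\<close> is compared with the constant \<open>W u\<close>; the defect
    \<open>D (v, W u) - W u\<close> vanishes as \<open>v\<close> tends to \<open>u\<close>.\<close>
  have "(W \<longlongrightarrow> W u) (at u)" for u
  proof -
    have "norm (W v - D (v, W u)) \<le> k * norm (W v - W u)" for v
      using contr[of v "W v" "W u"] by (simp add: W)
    moreover have "((\<lambda>v. D (v, W u) - W u) \<longlongrightarrow> 0) (at u)"
    proof -
      have "continuous_on UNIV (\<lambda>v. D (v, W u))"
        by (intro continuous_on_compose2[OF cont] continuous_intros) auto
      then have "((\<lambda>v. D (v, W u)) \<longlongrightarrow> D (u, W u)) (at u)"
        by (simp add: continuous_on_def)
      then show ?thesis by (simp add: W LIM_zero_iff)
    qed
    ultimately have "((\<lambda>v. W v - W u) \<longlongrightarrow> 0) (at u)"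
      using \<open>k < 1\<close> by (intro tendsto_contraction_perturbation[of W "\<lambda>v. D (v, W u)" k "\<lambda>v. W u"]) auto
    then show ?thesis by (simp add: LIM_zero_iff)
  qed
  then have "W \<in> cont_linear_maps"
    using linW by (simp add: cont_linear_maps_def continuous_on_def)
  with W that show thesis by metis
qed

section \<open>Smoothness of the fixed-point map\<close>

lemma C1F_on_fixed_point:
  fixes A :: "'t::topological_real_vector \<times> 'b::banach \<Rightarrow> 'b"
  assumes "open V" "open O\<^sub>B" and A: "C1F_on (V \<times> O\<^sub>B) A" and k: "0 \<le> k" "k < 1"
    and lip: "\<And>t x y. t \<in> V \<Longrightarrow> x \<in> O\<^sub>B \<Longrightarrow> y \<in> O\<^sub>B \<Longrightarrow>
           norm (A (t, x) - A (t, y)) \<le> k * norm (x - y)"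
    and g: "\<And>t. t \<in> V \<Longrightarrow> g t \<in> O\<^sub>B" "\<And>t. t \<in> V \<Longrightarrow> A (t, g t) = g t"
  shows "C1F_on V g"
proof -
  define D where "D t = dir_deriv A (t, g t)" for t
  have D: "D t \<in> cont_linear_maps" if "t \<in> V" for t
    unfolding D_def by (rule C1F_on_dir_deriv_cont_linear[OF A]) (use that g in auto)
  have D_le: "norm (D t (0, y)) \<le> k * norm y" if "t \<in> V" for t y
    unfolding D_def using assms that by (intro norm_dir_deriv_le_lipschitz[OF A]) auto
  have "\<exists>W. W \<in> cont_linear_maps \<and> (\<forall>v. W v = D t (v, W v))" if "t \<in> V" for t
    by (rule linear_fixed_point[OF D[OF that] k D_le[OF that]]) blast
  then obtain W where W: "\<And>t. t \<in> V \<Longrightarrow> W t \<in> cont_linear_maps"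
    "\<And>t v. t \<in> V \<Longrightarrow> D t (v, W t v) = W t v"
    by metis
  have contA: "continuous_on (V \<times> O\<^sub>B) A" using A by (simp add: C1F_on_def)
  have contg: "continuous_on V g"
    unfolding continuous_on_def
  proof
    fix t assume t: "t \<in> V"
    \<comment> \<open>The second argument is frozen at \<open>g t\<close>, so only continuity of
      \<open>A\<close> in the parameter remains to be used.\<close>
    have "norm (g s - A (s, g t)) \<le> k * norm (g s - g t)" if "s \<in> V" for s
      using lip[of s "g s" "g t"] g that t by simp
    then have "\<forall>\<^sub>F s in at t within V. norm (g s - A (s, g t)) \<le> k * norm (g s - g t)"
      by (auto simp: eventually_at_filter)
    moreover have "((\<lambda>s. A (s, g t) - g t) \<longlongrightarrow> 0) (at t within V)"
    proof -
      have "continuous_on V (\<lambda>s. A (s, g t))"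
        using g(1)[OF t] by (intro continuous_on_compose2[OF contA] continuous_intros) auto
      then have "((\<lambda>s. A (s, g t)) \<longlongrightarrow> A (t, g t)) (at t within V)"
        using t by (simp add: continuous_on_def)
      then show ?thesis
        using t by (simp add: g(2) LIM_zero)
    qed
    ultimately have "((\<lambda>s. g s - g t) \<longlongrightarrow> 0) (at t within V)"
      using k by (intro tendsto_contraction_perturbation[of g "\<lambda>s. A (s, g t)" k "\<lambda>s. g t"])
    then show "(g \<longlongrightarrow> g t) (at t within V)" by (simp add: LIM_zero_iff)
  qed
  show ?thesis
  proof (rule C1F_onI[where D = W])
    fix t v assume t: "t \<in> V"
    define w where "w = W t v"
    have "\<forall>\<^sub>F h in at 0. norm (dir_quotient g t v h - dir_quotient A (t, g t) (v, w) h)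
        \<le> k * norm (dir_quotient g t v h - w)"
      using eventually_neq_at_within[of 0] eventually_direction_in_open[OF \<open>open V\<close> t, of v]
        eventually_direction_in_open[OF \<open>open O\<^sub>B\<close> g(1)[OF t], of w]
    proof eventually_elim
      case (elim h)
      \<comment> \<open>The base terms cancel because \<open>A (t, g t) = g t\<close>. What is left
        compares two values of \<open>A\<close> at the same parameter, so the Lipschitz condition
        applies.\<close>
      have "dir_quotient g t v h - dir_quotient A (t, g t) (v, w) h
          = (1 / h) *\<^sub>R (A (t + h *\<^sub>R v, g (t + h *\<^sub>R v)) - A (t + h *\<^sub>R v, g t + h *\<^sub>R w))"
        using elim t by (simp add: dir_quotient_def g(2) flip: scaleR_diff_right)
      then have "norm (dir_quotient g t v h - dir_quotient A (t, g t) (v, w) h)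
          \<le> \<bar>1 / h\<bar> * (k * norm (g (t + h *\<^sub>R v) - (g t + h *\<^sub>R w)))"
        using elim g(1) by (simp only: norm_scaleR) (intro mult_left_mono lip, auto)
      also have "\<dots> = k * norm ((1 / h) *\<^sub>R (g (t + h *\<^sub>R v) - (g t + h *\<^sub>R w)))"
        by (simp only: norm_scaleR mult_ac)
      also have "(1 / h) *\<^sub>R (g (t + h *\<^sub>R v) - (g t + h *\<^sub>R w)) = dir_quotient g t v h - w"
        using elim by (simp add: dir_quotient_def algebra_simps)
      finally show ?case .
    qed
    \<comment> \<open>The quotient of \<open>A\<close> tends to \<open>D t (v, w)\<close>, which
      equals \<open>w\<close> by the choice of \<open>w\<close>.\<close>
    moreover have "((\<lambda>h. dir_quotient A (t, g t) (v, w) h - w) \<longlongrightarrow> 0) (at 0)"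
      using C1F_on_tendsto_dir_deriv[OF A, of "(t, g t)" "(v, w)"] W(2)[OF t, of v] t g(1)
      by (simp add: D_def w_def LIM_zero)
    ultimately have "((\<lambda>h. dir_quotient g t v h - w) \<longlongrightarrow> 0) (at 0)"
      using k by (intro tendsto_contraction_perturbation
          [of "dir_quotient g t v" "dir_quotient A (t, g t) (v, w)" k "\<lambda>h. w"])
    then show "(dir_quotient g t v \<longlongrightarrow> W t v) (at 0)"
      by (simp add: LIM_zero_iff w_def)
  next
    fix t and B :: "'t set" and e :: real assume t: "t \<in> V" and B: "tvs_bounded B" and e: "0 < e"
    have "(\<lambda>v. (v, W t v)) \<in> cont_linear_maps"
      using W(1)[OF t] by (auto simp: cont_linear_maps_def linear_iff intro!: continuous_intros)
    then have bdd: "tvs_bounded ((\<lambda>v. (v, W t v)) ` B)"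
      using B by (rule tvs_bounded_linear_image)
    have "continuous_map (top_of_set V) (top_of_set (V \<times> O\<^sub>B)) (\<lambda>s. (s, g s))"
      using contg g(1) by (auto intro!: continuous_intros)
    moreover have "continuous_map (top_of_set (V \<times> O\<^sub>B)) beta_topology (dir_deriv A)"
      using A by (simp add: C1F_on_def)
    ultimately have "continuous_map (top_of_set V) beta_topology (dir_deriv A \<circ> (\<lambda>s. (s, g s)))"
      by (rule continuous_map_compose)
    moreover have "dir_deriv A \<circ> (\<lambda>s. (s, g s)) = D"
      by (simp add: fun_eq_iff D_def)
    ultimately have "continuous_map (top_of_set V) beta_topology D"
      by simp
    \<comment> \<open>The factor \<open>1 - k\<close> compensates for the division by
      \<open>1 - k\<close> in the perturbation estimate.\<close>
    moreover have "0 < e * (1 - k)" using e k by simp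
    ultimately have "\<forall>\<^sub>F s in at t within V.
        \<forall>p\<in>(\<lambda>v. (v, W t v)) ` B. norm (D s p - D t p) < e * (1 - k)"
      using t bdd unfolding continuous_map_beta_topology_iff by blast
    moreover have "\<forall>\<^sub>F s in at t within V. s \<in> V"
      by (simp add: eventually_at_filter)
    ultimately show "\<forall>\<^sub>F s in at t within V. \<forall>v\<in>B. norm (W s v - W t v) < e"
    proof eventually_elim
      case (elim s)
      show ?case
      proof
        fix v assume "v \<in> B"
        \<comment> \<open>\<open>W s v\<close> is the fixed point of
          \<open>y \<mapsto> D s (v, y)\<close>, and \<open>W t v\<close> is the point compared with
          it. Since \<open>W t v = D t (v, W t v)\<close>, the defect is \<open>D s - D t\<close> at
          the pair \<open>(v, W t v)\<close>.\<close>
        have "linear (D s)" using D elim by (simp add: cont_linear_maps_def)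
        then have "W s v - D s (v, W t v) = D s (0, W s v - W t v)"
          using linear_diff[of "D s" "(v, W s v)" "(v, W t v)"] W(2) elim by simp
        then have "norm (W s v - W t v) \<le> norm (D s (v, W t v) - W t v) / (1 - k)"
          using D_le elim k by (intro contraction_perturbation) auto
        also have "\<dots> < e"
          using bspec[OF elim(1) imageI[OF \<open>v \<in> B\<close>]] k by (simp add: W(2)[OF t] divide_simps)
        finally show "norm (W s v - W t v) < e" .
      qed
    qed
  qed (use \<open>open V\<close> contg W(1) in auto)
qed

text \<open>The equation determines \<open>g\<close> only on \<open>V\<close>, while functions are
  total. The map is therefore expressed by unique solvability in \<open>M\<close> for each
  \<open>t\<close>, together with smoothness of every function that solves the equation on
  \<open>V\<close>. Banach's theorem on the complete set \<open>M\<close> gives the first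
  claim.\<close>

theorem theorem5p2:
  fixes V :: "'t::frechet_space set"
    and O\<^sub>B M :: "'b::banach set"
    and A :: "'t \<times> 'b \<Rightarrow> 'b"
    and k :: real
  assumes "open V" and "open O\<^sub>B"
    and "C1F_on (V \<times> O\<^sub>B) A"
    and "M \<noteq> {}" and "closed M" and "M \<subseteq> O\<^sub>B"
    and "A ` (V \<times> M) \<subseteq> M"
    and "0 \<le> k" and "k < 1"
    and "\<And>t x y. t \<in> V \<Longrightarrow> x \<in> O\<^sub>B \<Longrightarrow> y \<in> O\<^sub>B \<Longrightarrow>
           norm (A (t, x) - A (t, y)) \<le> k * norm (x - y)"
  shows "(\<forall>t\<in>V. \<exists>!x. x \<in> M \<and> x = A (t, x)) \<and>
         (\<forall>g. (\<forall>t\<in>V. g t \<in> M \<and> g t = A (t, g t)) \<longrightarrow> C1F_on V g)"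
proof (intro conjI ballI allI impI)
  fix t assume t: "t \<in> V"
  have "\<exists>!x. x \<in> M \<and> A (t, x) = x"
  proof (rule Banach_fix)
    show "complete M" using \<open>closed M\<close> by (simp add: complete_eq_closed)
    show "(\<lambda>x. A (t, x)) ` M \<subseteq> M" using assms(7) t by blast
    show "dist (A (t, x)) (A (t, y)) \<le> k * dist x y" if "x \<in> M" "y \<in> M" for x y
      using assms(6,10) t that by (simp add: dist_norm subset_iff)
  qed (fact assms)+
  then show "\<exists>!x. x \<in> M \<and> x = A (t, x)"
    by (simp add: eq_commute)
next
  fix g assume "\<forall>t\<in>V. g t \<in> M \<and> g t = A (t, g t)"
  then have g: "g t \<in> O\<^sub>B" "A (t, g t) = g t" if "t \<in> V" for t
    using that \<open>M \<subseteq> O\<^sub>B\<close> by auto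
  show "C1F_on V g"
    by (rule C1F_on_fixed_point[OF assms(1,2,3,8,9,10) g])
qed

end
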